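(* Let $G$ be a residually nilpotent group, i.e. $\bigcap_{s\ge 1}\Gamma^s(G)=\{1\}$, and let $q\ge 1$. Suppose that the graded Lie algebra $\mathrm{gr}_\Gamma(G)$ has trivial center and that $J\circ\iota_F\colon \mathrm{gr}^s_\Gamma(\mathcal{T}_G)\to \mathrm{Der}^s(\mathrm{gr}_\Gamma(G))$ is injective for all $s\le q$. Then, for each $1\le s\le q+1$, there is an exact sequence $$1\to \Gamma^s(G)\xrightarrow{\ \mathrm{Ad}\ }\Gamma^s(\mathcal{T}_G)\xrightarrow{\ \pi\ }\Gamma^s(\widetilde{\mathcal{T}}_G)\to 1,$$ where the maps are the restrictions of $\mathrm{Ad}\colon G\to\mathcal{T}_G$ and of the canonical projection $\pi\colon \mathcal{T}_G\to\widetilde{\mathcal{T}}_G$.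
   Context: For a group $G$, $(x,y)=xyx^{-1}y^{-1}$, $\Gamma^1(G)=G$, $\Gamma^{s+1}(G)=(\Gamma^s(G),G)$ is the lower central series, and $\mathrm{gr}_\Gamma(G)=\bigoplus_{s\ge1}\Gamma^s(G)/\Gamma^{s+1}(G)$ is the associated graded Lie algebra (over $\mathbb{Z}$), with bracket induced by the group commutator. The Johnson filtration on $\mathrm{Aut}(G)$ (product = composition) is $F^s=\{\alpha\in \mathrm{Aut}(G)\mid \alpha(x)x^{-1}\in\Gamma^{s+1}(G)\ \forall x\in G\}$, $s\ge 0$; it satisfies $(F^s,F^t)\subseteq F^{s+t}$. The Torelli group is $\mathcal{T}_G=F^1=\ker(\mathrm{Aut}(G)\to \mathrm{Aut}(G_{\mathrm{ab}}))$, and $\mathrm{gr}_F(\mathcal{T}_G)=\bigoplus_{s\ge1}F^s/F^{s+1}$ is a graded Lie algebra. Since $\Gamma^s(\mathcal{T}_G)\subseteq F^s$, there is a canonical morphism of graded Lie algebras $\iota_F\colon\mathrm{gr}_\Gamma(\mathcal{T}_G)\to\mathrm{gr}_F(\mathcal{T}_G)$. For a graded Lie algebra $\mathfrak{g}$, $\mathrm{Der}(\mathfrak{g})=\bigoplus_{s\ge1}\mathrm{Der}^s(\mathfrak{g})$, where $\mathrm{Der}^s(\mathfrak{g})$ is the set of linear derivations of $\mathfrak{g}$ raising degree by $s$, with bracket the commutator. The Johnson homomorphism $J\colon \mathrm{gr}_F(\mathcal{T}_G)\to\mathrm{Der}(\mathrm{gr}_\Gamma(G))$ is the (well-defined, injective)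 morphism of graded Lie algebras given by $J(\bar\alpha)(\bar x)=\overline{\alpha(x)x^{-1}}\in\mathrm{gr}^{s+t}_\Gamma(G)$ for $\alpha\in F^s$, $x\in\Gamma^t(G)$. $\mathrm{Ad}\colon G\to\mathrm{Aut}(G)$ sends $x$ to $\mathrm{Ad}_x\colon y\mapsto xyx^{-1}$; its image $\mathrm{Inn}(G)$ lies in $\mathcal{T}_G$. $\pi\colon\mathrm{Aut}(G)\to\mathrm{Out}(G)=\mathrm{Aut}(G)/\mathrm{Inn}(G)$ is the projection and $\widetilde{\mathcal{T}}_G=\pi(\mathcal{T}_G)\cong \mathcal{T}_G/\mathrm{Inn}(G)$ is the outer Torelli group. *)

theory Defs
  imports "HOL-Algebra.FiniteProduct" "HOL-Algebra.Product_Groups" "HOL-Algebra.Bij"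
begin

section \<open>Lower central series\<close>

definition commutator :: "('a, 'b) monoid_scheme \<Rightarrow> 'a \<Rightarrow> 'a \<Rightarrow> 'a"
  where "commutator G x y = x \<otimes>\<^bsub>G\<^esub> y \<otimes>\<^bsub>G\<^esub> inv\<^bsub>G\<^esub> x \<otimes>\<^bsub>G\<^esub> inv\<^bsub>G\<^esub> y"

definition commutator_subgroup :: "('a, 'b) monoid_scheme \<Rightarrow> 'a set \<Rightarrow> 'a set \<Rightarrow> 'a set"
  where "commutator_subgroup G H K = generate G (\<Union>x\<in>H. \<Union>y\<in>K. {commutator G x y})"

text \<open>The series is indexed from \<open>1\<close>, with \<open>\<Gamma>\<^sup>1(G) = G\<close>; the value at \<open>0\<close> is a convention.\<close>

fun lower_central :: "('a, 'b) monoid_scheme \<Rightarrow> nat \<Rightarrow> 'a set"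
  where
    "lower_central G 0 = carrier G"
  | "lower_central G (Suc 0) = carrier G"
  | "lower_central G (Suc (Suc s)) =
       commutator_subgroup G (lower_central G (Suc s)) (carrier G)"

definition residually_nilpotent :: "('a, 'b) monoid_scheme \<Rightarrow> bool"
  where "residually_nilpotent G \<longleftrightarrow> (\<Inter>s\<in>{1..}. lower_central G s) = {\<one>\<^bsub>G\<^esub>}"


section \<open>Graded Lie algebras over the integers\<close>

text \<open>
  The underlying abelian group is written multiplicatively, so that quotient groups and
  \<^const>\<open>sum_group\<close> can be used directly.  \<open>component L s\<close> is the homogeneous part of degree \<open>s \<ge> 1\<close>.
\<close>

record 'a graded_lie = "'a monoid" +
  bracket :: "'a \<Rightarrow> 'a \<Rightarrow> 'a"
  component :: "nat \<Rightarrow> 'a set"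

definition lie_center :: "('a, 'b) graded_lie_scheme \<Rightarrow> 'a set"
  where "lie_center L = {z \<in> carrier L. \<forall>x \<in> carrier L. bracket L z x = \<one>\<^bsub>L\<^esub>}"

definition derivations :: "('a, 'b) graded_lie_scheme \<Rightarrow> nat \<Rightarrow> ('a \<Rightarrow> 'a) set"
  where "derivations L s =
    {D \<in> hom L L \<inter> extensional (carrier L).
       (\<forall>u \<in> carrier L. \<forall>v \<in> carrier L.
          D (bracket L u v) = bracket L (D u) v \<otimes>\<^bsub>L\<^esub> bracket L u (D v)) \<and>
       (\<forall>t \<ge> 1. D ` component L t \<subseteq> component L (s + t))}"


section \<open>The graded Lie algebra associated with a filtration\<close>

definition gr_piece :: "('a, 'b) monoid_scheme \<Rightarrow> (nat \<Rightarrow> 'a set) \<Rightarrow> nat \<Rightarrow> 'a set monoid"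
  where "gr_piece G K s = (G\<lparr>carrier := K s\<rparr>) Mod (K (Suc s))"

definition gr_piece_bracket ::
    "('a, 'b) monoid_scheme \<Rightarrow> (nat \<Rightarrow> 'a set) \<Rightarrow> nat \<Rightarrow> nat \<Rightarrow> 'a set \<Rightarrow> 'a set \<Rightarrow> 'a set"
  where "gr_piece_bracket G K s t A B =
    the_elem (\<Union>x\<in>A. \<Union>y\<in>B. {K (Suc (s + t)) #>\<^bsub>G\<^esub> commutator G x y})"

text \<open>
  The direct sum of the pieces of degree \<open>s \<ge> 1\<close>.  An element is a family \<open>u\<close> of finite support
  with \<open>u s \<in> K s / K (s + 1)\<close>, and the bracket is the bilinear extension of the one induced by
  the group commutator: \<open>[u, v]\<^sub>n\<close> is the sum of all \<open>[u\<^sub>s, v\<^sub>t]\<close> with \<open>s, t \<ge> 1\<close> and \<open>s + t = n\<close>.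
\<close>

definition gr :: "('a, 'b) monoid_scheme \<Rightarrow> (nat \<Rightarrow> 'a set) \<Rightarrow> (nat \<Rightarrow> 'a set) graded_lie"
  where "gr G K =
    \<lparr>carrier = carrier (sum_group {1..} (gr_piece G K)),
     mult = mult (sum_group {1..} (gr_piece G K)),
     one = one (sum_group {1..} (gr_piece G K)),
     bracket = (\<lambda>u v. \<lambda>n\<in>{1..}.
       (\<Otimes>\<^bsub>gr_piece G K n\<^esub>s\<in>{1..<n}. gr_piece_bracket G K s (n - s) (u s) (v (n - s)))),
     component = (\<lambda>s. {u \<in> carrier (sum_group {1..} (gr_piece G K)).
       \<forall>n\<in>{1..}. n \<noteq> s \<longrightarrow> u n = \<one>\<^bsub>gr_piece G K n\<^esub>})\<rparr>"

definition gr_class :: "('a, 'b) monoid_scheme \<Rightarrow> (nat \<Rightarrow> 'a set) \<Rightarrow> nat \<Rightarrow> 'a \<Rightarrow> nat \<Rightarrow> 'a set"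
  where "gr_class G K t x =
    (\<lambda>n\<in>{1..}. if n = t then K (Suc t) #>\<^bsub>G\<^esub> x else \<one>\<^bsub>gr_piece G K n\<^esub>)"

abbreviation gr_lcs :: "('a, 'b) monoid_scheme \<Rightarrow> (nat \<Rightarrow> 'a set) graded_lie"
  where "gr_lcs G \<equiv> gr G (lower_central G)"


section \<open>Johnson filtration, Torelli groups, Johnson homomorphism\<close>

definition johnson_filtration :: "('a, 'b) monoid_scheme \<Rightarrow> nat \<Rightarrow> ('a \<Rightarrow> 'a) set"
  where "johnson_filtration G s =
    {\<alpha> \<in> auto G. \<forall>x \<in> carrier G. \<alpha> x \<otimes>\<^bsub>G\<^esub> inv\<^bsub>G\<^esub> x \<in> lower_central G (Suc s)}"

definition torelli :: "('a, 'b) monoid_scheme \<Rightarrow> ('a \<Rightarrow> 'a) monoid"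
  where "torelli G = (AutoGroup G)\<lparr>carrier := johnson_filtration G 1\<rparr>"

text \<open>Degree \<open>s\<close> part of \<open>\<iota>\<^sub>F\<close>: the class of \<open>\<alpha> \<in> \<Gamma>\<^sup>s(\<T>\<^sub>G)\<close> goes to the class of \<open>\<alpha> \<in> F\<^sup>s\<close>.\<close>

definition iota_F :: "('a, 'b) monoid_scheme \<Rightarrow> nat \<Rightarrow> ('a \<Rightarrow> 'a) set \<Rightarrow> ('a \<Rightarrow> 'a) set"
  where "iota_F G s A =
    the_elem (\<Union>\<alpha>\<in>A. {johnson_filtration G (Suc s) #>\<^bsub>torelli G\<^esub> \<alpha>})"

text \<open>
  Degree \<open>s\<close> part of the Johnson homomorphism, on a class \<open>A \<in> F\<^sup>s / F\<^sup>s\<^sup>+\<^sup>1\<close>: the derivation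
  sending the class of \<open>x \<in> \<Gamma>\<^sup>t(G)\<close> to the class of \<open>\<alpha>(x) x\<^sup>-\<^sup>1\<close> in degree \<open>s + t\<close>, for \<open>\<alpha> \<in> A\<close>.
  It is unique because the homogeneous elements generate \<open>gr\<^sub>\<Gamma>(G)\<close>.
\<close>

definition johnson_hom ::
    "('a, 'b) monoid_scheme \<Rightarrow> nat \<Rightarrow> ('a \<Rightarrow> 'a) set \<Rightarrow> (nat \<Rightarrow> 'a set) \<Rightarrow> (nat \<Rightarrow> 'a set)"
  where "johnson_hom G s A =
    (THE D. D \<in> derivations (gr_lcs G) s \<and>
       (\<forall>\<alpha>\<in>A. \<forall>t\<ge>1. \<forall>x\<in>lower_central G t.
          D (gr_class G (lower_central G) t x) =
          gr_class G (lower_central G) (s + t) (\<alpha> x \<otimes>\<^bsub>G\<^esub> inv\<^bsub>G\<^esub> x)))"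

definition Ad :: "('a, 'b) monoid_scheme \<Rightarrow> 'a \<Rightarrow> 'a \<Rightarrow> 'a"
  where "Ad G x = (\<lambda>y \<in> carrier G. x \<otimes>\<^bsub>G\<^esub> y \<otimes>\<^bsub>G\<^esub> inv\<^bsub>G\<^esub> x)"

definition Inn :: "('a, 'b) monoid_scheme \<Rightarrow> ('a \<Rightarrow> 'a) set"
  where "Inn G = Ad G ` carrier G"

definition Out :: "('a, 'b) monoid_scheme \<Rightarrow> ('a \<Rightarrow> 'a) set monoid"
  where "Out G = AutoGroup G Mod Inn G"

definition out_proj :: "('a, 'b) monoid_scheme \<Rightarrow> ('a \<Rightarrow> 'a) \<Rightarrow> ('a \<Rightarrow> 'a) set"
  where "out_proj G \<alpha> = Inn G #>\<^bsub>AutoGroup G\<^esub> \<alpha>"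

definition outer_torelli :: "('a, 'b) monoid_scheme \<Rightarrow> ('a \<Rightarrow> 'a) set monoid"
  where "outer_torelli G = (Out G)\<lparr>carrier := out_proj G ` carrier (torelli G)\<rparr>"


section \<open>Short exact sequences\<close>

text \<open>
  The library's \<open>exact_seq\<close> requires all groups to have the same type of elements.
\<close>

definition short_exact ::
    "('a, 'x) monoid_scheme \<Rightarrow> ('b, 'y) monoid_scheme \<Rightarrow> ('c, 'z) monoid_scheme \<Rightarrow>
     ('a \<Rightarrow> 'b) \<Rightarrow> ('b \<Rightarrow> 'c) \<Rightarrow> bool"
  where "short_exact A B C f g \<longleftrightarrow>
    group_hom A B f \<and> group_hom B C g \<and> inj_on f (carrier A) \<and>
    f ` carrier A = kernel B C g \<and> g ` carrier B = carrier C"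

end

theory Submission
  imports Defs
begin

text \<open>
  Let \<open>E\<^sup>s\<close> be the group of automorphisms \<open>\<alpha>\<close> with \<open>\<alpha>(y) y\<^sup>-\<^sup>1 \<in> \<Gamma>\<^sup>s\<^sup>+\<^sup>u\<close> for all
  \<open>u \<ge> 1\<close> and \<open>y \<in> \<Gamma>\<^sup>u(G)\<close>.  Then \<open>(E\<^sup>s, E\<^sup>1) \<subseteq> E\<^sup>s\<^sup>+\<^sup>1\<close>, so the lower central series
  of any group mapping to \<open>E\<^sup>1\<close> maps to the filtration \<open>E\<close>.  Applied to \<open>Ad\<close> this gives
  \<open>(\<Gamma>\<^sup>s, \<Gamma>\<^sup>u) \<subseteq> \<Gamma>\<^sup>s\<^sup>+\<^sup>u\<close>, and applied to the Torelli group, which equals \<open>E\<^sup>1\<close>, it gives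
  \<open>\<Gamma>\<^sup>s(\<T>\<^sub>G) \<subseteq> E\<^sup>s\<close>.  If \<open>Ad x \<in> E\<^sup>s\<close> and \<open>x \<in> \<Gamma>\<^sup>t(G)\<close> with \<open>t < s\<close>, then the class of
  \<open>x\<close> in degree \<open>t\<close> is central in \<open>gr\<^sub>\<Gamma>(G)\<close>, hence \<open>0\<close>; inductively \<open>x \<in> \<Gamma>\<^sup>s(G)\<close>.  So an inner
  automorphism in \<open>\<Gamma>\<^sup>s(\<T>\<^sub>G)\<close> comes from \<open>\<Gamma>\<^sup>s(G)\<close>, which is exactness in the middle.
  The same argument for all \<open>s\<close>, with residual nilpotence, shows that \<open>Ad\<close> is injective.
\<close>

declare lower_central.simps(3) [simp del]

section \<open>Commutators and the lower central series\<close>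

context group
begin

lemma inv_cancel_left [simp]:
  "\<lbrakk>x \<in> carrier G; y \<in> carrier G\<rbrakk> \<Longrightarrow> inv x \<otimes> (x \<otimes> y) = y"
  "\<lbrakk>x \<in> carrier G; y \<in> carrier G\<rbrakk> \<Longrightarrow> x \<otimes> (inv x \<otimes> y) = y"
  by (simp_all flip: m_assoc)

lemma commutator_closed [simp]:
  "\<lbrakk>x \<in> carrier G; y \<in> carrier G\<rbrakk> \<Longrightarrow> commutator G x y \<in> carrier G"
  by (simp add: commutator_def)

lemma inv_commutator:
  "\<lbrakk>x \<in> carrier G; y \<in> carrier G\<rbrakk> \<Longrightarrow> inv (commutator G x y) = commutator G y x"
  by (simp add: commutator_def inv_mult_group m_assoc)

lemma conj_commutator:
  "\<lbrakk>g \<in> carrier G; x \<in> carrier G; y \<in> carrier G\<rbrakk> \<Longrightarrow>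
    g \<otimes> commutator G x y \<otimes> inv g = commutator G (g \<otimes> x \<otimes> inv g) (g \<otimes> y \<otimes> inv g)"
  by (simp add: commutator_def inv_mult_group m_assoc)

lemma commutator_mult_left:
  "\<lbrakk>a \<in> carrier G; x \<in> carrier G; w \<in> carrier G\<rbrakk> \<Longrightarrow>
    commutator G (a \<otimes> x) w = a \<otimes> commutator G x w \<otimes> inv a \<otimes> commutator G a w"
  by (simp add: commutator_def inv_mult_group m_assoc)

lemma commutator_mult_right:
  "\<lbrakk>x \<in> carrier G; c \<in> carrier G; z \<in> carrier G\<rbrakk> \<Longrightarrow>
    commutator G x (c \<otimes> z) = commutator G x c \<otimes> (c \<otimes> commutator G x z \<otimes> inv c)"
  by (simp add: commutator_def inv_mult_group m_assoc)

lemma conj_eq_commutator_mult: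
  "\<lbrakk>a \<in> carrier G; x \<in> carrier G\<rbrakk> \<Longrightarrow> a \<otimes> x \<otimes> inv a = commutator G a x \<otimes> x"
  by (simp add: commutator_def inv_mult_group m_assoc)

text \<open>Conjugation is a homomorphism, so it carries generating commutators to generating
  commutators.\<close>

lemma commutator_subgroup_normal:
  assumes "H \<lhd> G" "K \<lhd> G"
  shows "commutator_subgroup G H K \<lhd> G"
proof -
  interpret H: normal H G by fact
  interpret K: normal K G by fact
  show ?thesis
    unfolding commutator_subgroup_def
  proof (rule normal_generateI)
    show "(\<Union>x\<in>H. \<Union>y\<in>K. {commutator G x y}) \<subseteq> carrier G"
      by auto
    fix h g assume "h \<in> (\<Union>x\<in>H. \<Union>y\<in>K. {commutator G x y})" and g: "g \<in> carrier G"
    then obtain x y where xy: "x \<in> H" "y \<in> K" "h = commutator G x y" by auto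
    then have "g \<otimes> h \<otimes> inv g = commutator G (g \<otimes> x \<otimes> inv g) (g \<otimes> y \<otimes> inv g)"
      using g by (simp add: conj_commutator)
    then show "g \<otimes> h \<otimes> inv g \<in> (\<Union>x\<in>H. \<Union>y\<in>K. {commutator G x y})"
      using H.inv_op_closed2[OF g xy(1)] K.inv_op_closed2[OF g xy(2)] by auto
  qed
qed

lemma carrier_normal: "carrier G \<lhd> G"
  by (rule normal_invI) (auto simp: subgroup_self)

lemma lower_central_normal: "lower_central G s \<lhd> G"
proof (induction s)
  case 0
  then show ?case by (simp add: carrier_normal)
next
  case (Suc s)
  then show ?case by (cases s) (simp_all add: lower_central.simps(3) carrier_normal commutator_subgroup_normal)
qed

lemma lower_central_subgroup: "subgroup (lower_central G s) G"
  using lower_central_normal normal_imp_subgroup by blast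

lemma lower_central_subset: "lower_central G s \<subseteq> carrier G"
  using lower_central_subgroup subgroup.subset by blast

lemma lower_central_carrier [simp]: "x \<in> lower_central G s \<Longrightarrow> x \<in> carrier G"
  using lower_central_subset by blast

lemma commutator_mem_lower_central_Suc:
  assumes "1 \<le> s" "x \<in> lower_central G s" "y \<in> carrier G"
  shows "commutator G x y \<in> lower_central G (Suc s)"
  using assms
  by (cases s) (auto simp: lower_central.simps(3) commutator_subgroup_def intro!: generate.incl)

lemma lower_central_Suc_subset: "lower_central G (Suc s) \<subseteq> lower_central G s"
proof (cases s)
  case (Suc r)
  interpret N: normal "lower_central G s" G by (rule lower_central_normal)
  have "commutator G x y \<in> lower_central G s" if "x \<in> lower_central G s" "y \<in> carrier G" for x y
  proof -
    \<comment> \<open>As \<open>x\<close> times a conjugate of \<open>inv x\<close>, the commutator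
      stays in any normal subgroup containing \<open>x\<close>.\<close>
    have "commutator G x y = x \<otimes> (y \<otimes> inv x \<otimes> inv y)"
      using that by (simp add: commutator_def m_assoc)
    then show ?thesis using that N.inv_op_closed2 by simp
  qed
  then show ?thesis
    using Suc unfolding Suc lower_central.simps commutator_subgroup_def
    by (intro generate_subgroup_incl lower_central_subgroup[of "Suc r"]) auto
qed simp

end

section \<open>Lower central series under homomorphisms\<close>

lemma (in group_hom) hom_commutator:
  "\<lbrakk>x \<in> carrier G; y \<in> carrier G\<rbrakk> \<Longrightarrow> h (commutator G x y) = commutator H (h x) (h y)"
  by (simp add: commutator_def)

lemma (in group_hom) img_commutator_subgroup:
  assumes "A \<subseteq> carrier G" "B \<subseteq> carrier G"
  shows "h ` commutator_subgroup G A B = commutator_subgroup H (h ` A) (h ` B)"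
proof -
  let ?S = "\<Union>x\<in>A. \<Union>y\<in>B. {commutator G x y}"
  have "?S \<subseteq> carrier G" using assms G.commutator_closed by blast
  moreover have "h ` ?S = (\<Union>x\<in>h ` A. \<Union>y\<in>h ` B. {commutator H x y})"
  proof -
    have "h (commutator G x y) = commutator H (h x) (h y)" if "x \<in> A" "y \<in> B" for x y
      using that assms by (simp add: hom_commutator subset_iff)
    then show ?thesis by (force simp: image_iff)
  qed
  ultimately show ?thesis
    unfolding commutator_subgroup_def by (metis generate_img)
qed

text \<open>Surjectivity enters because the second argument of each commutator subgroup is the whole
  carrier. The lemma serves for automorphisms of \<open>G\<close> and for
  \<open>out_proj\<close>.\<close>

lemma (in group_hom) img_lower_central:
  assumes "h ` carrier G = carrier H"
  shows "h ` lower_central G s = lower_central H s"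
proof (induction s)
  case (Suc s)
  then show ?case
    using assms by (cases s) (simp_all add: lower_central.simps(3) img_commutator_subgroup G.lower_central_subset)
qed (simp add: assms)

lemma (in group_hom) img_lower_central_subset:
  "h ` lower_central G s \<subseteq> lower_central H s"
proof (induction s)
  case (Suc s)
  show ?case
  proof (cases s)
    case (Suc r)
    have "h ` lower_central G (Suc s) =
        commutator_subgroup H (h ` lower_central G s) (h ` carrier G)"
      using Suc by (simp add: lower_central.simps(3) img_commutator_subgroup G.lower_central_subset)
    also have "\<dots> \<subseteq> commutator_subgroup H (lower_central H s) (carrier H)"
      unfolding commutator_subgroup_def
      using Suc.IH by (intro H.mono_generate UN_mono) auto
    finally show ?thesis using Suc by (simp add: lower_central.simps(3))
  qed auto
qed auto


section \<open>Automorphisms shifting the lower central series\<close>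

text \<open>The condition ranges over all \<Gamma>^u, whereas \<open>johnson_filtration\<close>
  tests \<Gamma>^1 alone. One automorphism can thus be applied to the error terms of another, which
  lie deeper in the series.\<close>

definition lower_central_shift :: "('a, 'b) monoid_scheme \<Rightarrow> nat \<Rightarrow> ('a \<Rightarrow> 'a) set"
  where "lower_central_shift G s =
    {\<alpha> \<in> auto G. \<forall>u\<ge>1. \<forall>y\<in>lower_central G u. \<alpha> y \<otimes>\<^bsub>G\<^esub> inv\<^bsub>G\<^esub> y \<in> lower_central G (s + u)}"

context group
begin

lemma AutoGroup_simps:
  shows carrier_AutoGroup: "carrier (AutoGroup G) = auto G"
    and one_AutoGroup: "\<one>\<^bsub>AutoGroup G\<^esub> = (\<lambda>x\<in>carrier G. x)"
    and mult_AutoGroup: "\<lbrakk>\<alpha> \<in> auto G; \<beta> \<in> auto G\<rbrakk> \<Longrightarrow> \<alpha> \<otimes>\<^bsub>AutoGroup G\<^esub> \<beta> = compose (carrier G) \<alpha> \<beta>"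
  by (auto simp: AutoGroup_def BijGroup_def auto_def)

lemma auto_group_hom: "\<alpha> \<in> auto G \<Longrightarrow> group_hom G G \<alpha>"
  by unfold_locales (simp add: auto_def)

lemma auto_surj: "\<alpha> \<in> auto G \<Longrightarrow> \<alpha> ` carrier G = carrier G"
  by (simp add: auto_def Bij_def bij_betw_def)

lemma auto_closed [simp]: "\<lbrakk>\<alpha> \<in> auto G; x \<in> carrier G\<rbrakk> \<Longrightarrow> \<alpha> x \<in> carrier G"
  using auto_surj by blast

lemma auto_eqI:
  assumes "\<alpha> \<in> auto G" "\<beta> \<in> auto G" "\<And>x. x \<in> carrier G \<Longrightarrow> \<alpha> x = \<beta> x"
  shows "\<alpha> = \<beta>"
  using assms by (auto simp: auto_def Bij_def intro: extensionalityI)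

lemma auto_lower_central: "\<alpha> \<in> auto G \<Longrightarrow> \<alpha> ` lower_central G u = lower_central G u"
  by (intro group_hom.img_lower_central auto_group_hom auto_surj)

lemma AutoGroup_inv_apply:
  assumes "\<alpha> \<in> auto G" "x \<in> carrier G"
  shows "(inv\<^bsub>AutoGroup G\<^esub> \<alpha>) (\<alpha> x) = x"
proof -
  interpret A: group "AutoGroup G" by (rule AutoGroup)
  have inv: "inv\<^bsub>AutoGroup G\<^esub> \<alpha> \<in> auto G"
    using assms A.inv_closed by (simp add: carrier_AutoGroup)
  have "inv\<^bsub>AutoGroup G\<^esub> \<alpha> \<otimes>\<^bsub>AutoGroup G\<^esub> \<alpha> = \<one>\<^bsub>AutoGroup G\<^esub>"
    using assms by (simp add: carrier_AutoGroup)
  then show ?thesis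
    using assms inv by (simp add: mult_AutoGroup one_AutoGroup compose_def fun_eq_iff) metis
qed

lemma lower_central_shift_subset: "lower_central_shift G s \<subseteq> auto G"
  by (auto simp: lower_central_shift_def)

lemma lower_central_shiftE:
  assumes "\<alpha> \<in> lower_central_shift G s" "1 \<le> u" "y \<in> lower_central G u"
  obtains a where "a \<in> lower_central G (s + u)" "\<alpha> y = a \<otimes> y"
proof
  show "\<alpha> y \<otimes> inv y \<in> lower_central G (s + u)"
    using assms by (simp add: lower_central_shift_def)
  show "\<alpha> y = \<alpha> y \<otimes> inv y \<otimes> y"
    using assms lower_central_shift_subset[of s] by (simp add: m_assoc subset_iff)
qed

lemma lower_central_shift_subgroup: "subgroup (lower_central_shift G s) (AutoGroup G)"
proof -
  interpret A: group "AutoGroup G" by (rule AutoGroup)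
  have N: "subgroup (lower_central G t) G" for t by (rule lower_central_subgroup)
  show ?thesis
  proof (rule A.subgroupI)
    show "lower_central_shift G s \<subseteq> carrier (AutoGroup G)"
      by (simp add: lower_central_shift_subset carrier_AutoGroup)
    show "lower_central_shift G s \<noteq> {}"
      using id_in_auto subgroup.one_closed[OF N]
      by (auto simp: lower_central_shift_def intro!: exI[of _ "\<lambda>x\<in>carrier G. x"])
  next
    fix \<alpha> assume \<alpha>: "\<alpha> \<in> lower_central_shift G s"
    then have "\<alpha> \<in> auto G" using lower_central_shift_subset by blast
    then have inv: "inv\<^bsub>AutoGroup G\<^esub> \<alpha> \<in> auto G"
      using A.inv_closed by (simp add: carrier_AutoGroup)
    have "(inv\<^bsub>AutoGroup G\<^esub> \<alpha>) y \<otimes> inv y \<in> lower_central G (s + u)"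
      if u: "1 \<le> u" and y: "y \<in> lower_central G u" for u y
    proof -
      \<comment> \<open>As \<alpha> maps \<Gamma>^u onto itself, \<open>y\<close> has the form
        \<open>\<alpha> z = a \<otimes> z\<close>, and the inverse sends it to
        \<open>z = inv a \<otimes> y\<close>.\<close>
      obtain z where z: "z \<in> lower_central G u" "y = \<alpha> z"
        using y auto_lower_central[OF \<open>\<alpha> \<in> auto G\<close>] by blast
      obtain a where a: "a \<in> lower_central G (s + u)" "\<alpha> z = a \<otimes> z"
        using lower_central_shiftE[OF \<alpha> u z(1)] .
      have "(inv\<^bsub>AutoGroup G\<^esub> \<alpha>) y \<otimes> inv y = inv a"
        using z a \<open>\<alpha> \<in> auto G\<close> AutoGroup_inv_apply[of \<alpha> z]
        by (simp add: inv_mult_group)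
      then show ?thesis using a N by (simp add: subgroup.m_inv_closed)
    qed
    then show "inv\<^bsub>AutoGroup G\<^esub> \<alpha> \<in> lower_central_shift G s"
      using inv by (simp add: lower_central_shift_def)
  next
    fix \<alpha> \<beta> assume \<alpha>: "\<alpha> \<in> lower_central_shift G s" and \<beta>: "\<beta> \<in> lower_central_shift G s"
    then have auto: "\<alpha> \<in> auto G" "\<beta> \<in> auto G" using lower_central_shift_subset by auto
    then have "\<alpha> \<otimes>\<^bsub>AutoGroup G\<^esub> \<beta> \<in> auto G"
      using A.m_closed by (simp add: carrier_AutoGroup)
    moreover have "(\<alpha> \<otimes>\<^bsub>AutoGroup G\<^esub> \<beta>) y \<otimes> inv y \<in> lower_central G (s + u)"
      if u: "1 \<le> u" and y: "y \<in> lower_central G u" for u y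
    proof -
      obtain b where b: "b \<in> lower_central G (s + u)" "\<beta> y = b \<otimes> y"
        using lower_central_shiftE[OF \<beta> u y] .
      have "\<beta> y \<in> lower_central G u" using y auto auto_lower_central by blast
      then obtain a where a: "a \<in> lower_central G (s + u)" "\<alpha> (\<beta> y) = a \<otimes> \<beta> y"
        using lower_central_shiftE[OF \<alpha> u] by blast
      have "(\<alpha> \<otimes>\<^bsub>AutoGroup G\<^esub> \<beta>) y \<otimes> inv y = a \<otimes> b"
        using a b y auto by (simp add: mult_AutoGroup compose_def m_assoc)
      then show ?thesis using a b N by (simp add: subgroup.m_closed)
    qed
    ultimately show "\<alpha> \<otimes>\<^bsub>AutoGroup G\<^esub> \<beta> \<in> lower_central_shift G s"
      by (simp add: lower_central_shift_def)
  qed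
qed

text \<open>
  If \<open>\<alpha> y = a y\<close> and \<open>\<beta> y = b y\<close>, then \<open>\<alpha> (\<beta> y)\<close> and \<open>\<beta> (\<alpha> y)\<close> agree modulo
  \<open>\<Gamma>\<^sup>s\<^sup>+\<^sup>1\<^sup>+\<^sup>u\<close> up to the commutator of \<open>a\<close> and \<open>b\<close>, which lies in \<open>(\<Gamma>\<^sup>s\<^sup>+\<^sup>u, G)\<close>.  Taking the shift
  of \<open>\<beta>\<close> to be \<open>1\<close> makes this independent of \<open>(\<Gamma>\<^sup>s, \<Gamma>\<^sup>t) \<subseteq> \<Gamma>\<^sup>s\<^sup>+\<^sup>t\<close>, which is deduced from it.
\<close>

lemma commutator_lower_central_shift:
  assumes \<alpha>: "\<alpha> \<in> lower_central_shift G s" and \<beta>: "\<beta> \<in> lower_central_shift G 1"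
  shows "commutator (AutoGroup G) \<alpha> \<beta> \<in> lower_central_shift G (Suc s)"
proof -
  interpret A: group "AutoGroup G" by (rule AutoGroup)
  have N: "subgroup (lower_central G t) G" for t by (rule lower_central_subgroup)
  have auto: "\<alpha> \<in> auto G" "\<beta> \<in> auto G" using assms lower_central_shift_subset by auto
  define \<gamma> where "\<gamma> = commutator (AutoGroup G) \<alpha> \<beta>"
  have \<gamma>: "\<gamma> \<in> auto G"
    using auto A.commutator_closed by (simp add: \<gamma>_def carrier_AutoGroup)
  \<comment> \<open>With the inverses multiplied out, \<gamma> is evaluated only at points
    \<open>\<beta> (\<alpha> y)\<close>, and no inverse automorphism has to be computed.\<close>
  have "\<gamma> \<otimes>\<^bsub>AutoGroup G\<^esub> (\<beta> \<otimes>\<^bsub>AutoGroup G\<^esub> \<alpha>) = \<alpha> \<otimes>\<^bsub>AutoGroup G\<^esub> \<beta>"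
    using auto unfolding carrier_AutoGroup[symmetric]
    by (simp add: \<gamma>_def commutator_def A.m_assoc)
  moreover have "\<beta> \<otimes>\<^bsub>AutoGroup G\<^esub> \<alpha> \<in> auto G"
    using auto A.m_closed by (simp add: carrier_AutoGroup)
  ultimately have swap: "\<gamma> (\<beta> (\<alpha> y)) = \<alpha> (\<beta> y)" if "y \<in> carrier G" for y
    using auto \<gamma> that by (metis auto_closed compose_eq mult_AutoGroup)
  have "\<gamma> z \<otimes> inv z \<in> lower_central G (Suc s + u)"
    if u: "1 \<le> u" and z: "z \<in> lower_central G u" for u z
  proof -
    obtain y where y: "y \<in> lower_central G u" "z = \<beta> (\<alpha> y)"
      using z auto_lower_central[OF auto(1), of u] auto_lower_central[OF auto(2), of u]
      by (metis imageE)
    obtain a where a: "a \<in> lower_central G (s + u)" "\<alpha> y = a \<otimes> y"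
      using lower_central_shiftE[OF \<alpha> u y(1)] .
    obtain b where b: "b \<in> lower_central G (1 + u)" "\<beta> y = b \<otimes> y"
      using lower_central_shiftE[OF \<beta> u y(1)] .
    \<comment> \<open>The shifts are now applied to the errors \<open>a\<close> and \<open>b\<close>
      themselves; both second-order errors land in \<Gamma>^(s+1+u).\<close>
    obtain a' where a': "a' \<in> lower_central G (1 + (s + u))" "\<beta> a = a' \<otimes> a"
      using lower_central_shiftE[OF \<beta> _ a(1)] u by auto
    obtain b' where b': "b' \<in> lower_central G (s + (1 + u))" "\<alpha> b = b' \<otimes> b"
      using lower_central_shiftE[OF \<alpha> _ b(1)] by auto
    have c: "a \<in> carrier G" "b \<in> carrier G" "a' \<in> carrier G" "b' \<in> carrier G" "y \<in> carrier G"
      using a b a' b' y lower_central_carrier by blast+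
    have "\<gamma> z = b' \<otimes> b \<otimes> (a \<otimes> y)"
      using swap[OF c(5)] y(2) c b(2) b'(2) a(2) group_hom.hom_mult[OF auto_group_hom[OF auto(1)]] by simp
    moreover have "z = a' \<otimes> a \<otimes> (b \<otimes> y)"
      using y c a b a' group_hom.hom_mult[OF auto_group_hom[OF auto(2)]] by simp
    \<comment> \<open>The quotient of b' b a y by a' a b y is b' (b,a) a'^-1, whose three factors
      all lie in \<Gamma>^(s+1+u).\<close>
    ultimately have "\<gamma> z \<otimes> inv z = b' \<otimes> inv (commutator G a b) \<otimes> inv a'"
      using c by (simp add: inv_commutator) (simp add: commutator_def inv_mult_group m_assoc)
    moreover have "commutator G a b \<in> lower_central G (Suc s + u)"
      using commutator_mem_lower_central_Suc[OF _ a(1) c(2)] u by simp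
    ultimately show ?thesis
      using a' b' N[of "Suc s + u"] by (simp add: subgroup.m_closed subgroup.m_inv_closed)
  qed
  then show ?thesis using \<gamma> by (simp add: lower_central_shift_def \<gamma>_def)
qed

text \<open>An arbitrary source \<open>K\<close> covers both \<open>Ad\<close> and the inclusion of
  the Torelli group. In the induction it suffices to test commutators, since the shift sets are
  subgroups.\<close>

lemma hom_lower_central_shift:
  assumes h: "group_hom K (AutoGroup G) h" and sub: "h ` carrier K \<subseteq> lower_central_shift G 1"
    and "1 \<le> s"
  shows "h ` lower_central K s \<subseteq> lower_central_shift G s"
  using \<open>1 \<le> s\<close>
proof (induction s rule: dec_induct)
  case base
  then show ?case using sub by simp
next
  case (step s)
  interpret h: group_hom K "AutoGroup G" h by fact
  obtain r where r: "s = Suc r" using step by (cases s) auto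
  have "h ` lower_central K (Suc s) =
      commutator_subgroup (AutoGroup G) (h ` lower_central K s) (h ` carrier K)"
    unfolding r lower_central.simps
    by (rule h.img_commutator_subgroup) (auto simp: h.G.lower_central_subset)
  also have "\<dots> \<subseteq> lower_central_shift G (Suc s)"
    unfolding commutator_subgroup_def
    using step.IH sub commutator_lower_central_shift
    by (intro h.H.generate_subgroup_incl lower_central_shift_subgroup) blast
  finally show ?case .
qed


section \<open>Inner automorphisms\<close>

lemma Ad_apply: "y \<in> carrier G \<Longrightarrow> Ad G x y = x \<otimes> y \<otimes> inv x"
  by (simp add: Ad_def)

lemma Ad_auto:
  assumes "x \<in> carrier G"
  shows "Ad G x \<in> auto G"
proof -
  have "bij_betw (Ad G x) (carrier G) (carrier G)"
    using assms
    by (intro bij_betw_byWitness[where f' = "\<lambda>y. inv x \<otimes> y \<otimes> x"])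
       (auto simp: Ad_apply m_assoc)
  moreover have "Ad G x \<in> hom G G"
    using assms by (intro homI) (simp_all add: Ad_apply m_assoc)
  moreover have "Ad G x \<in> extensional (carrier G)"
    by (simp add: Ad_def)
  ultimately show ?thesis
    by (simp add: auto_def Bij_def)
qed

lemma Ad_group_hom: "group_hom G (AutoGroup G) (Ad G)"
proof -
  interpret A: group "AutoGroup G" by (rule AutoGroup)
  have "Ad G (x \<otimes> y) = Ad G x \<otimes>\<^bsub>AutoGroup G\<^esub> Ad G y" if "x \<in> carrier G" "y \<in> carrier G" for x y
    using that
    by (intro auto_eqI)
       (use A.m_closed in \<open>auto simp: Ad_auto carrier_AutoGroup mult_AutoGroup compose_def
          Ad_apply inv_mult_group m_assoc\<close>)
  then show ?thesis
    by unfold_locales (auto simp: hom_def Ad_auto carrier_AutoGroup)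
qed

lemma Ad_lower_central_shift: "x \<in> carrier G \<Longrightarrow> Ad G x \<in> lower_central_shift G 1"
proof -
  assume x: "x \<in> carrier G"
  have "Ad G x y \<otimes> inv y \<in> lower_central G (1 + u)" if "1 \<le> u" "y \<in> lower_central G u" for u y
  proof -
    \<comment> \<open>The element of \<Gamma>^u has to stand first in the commutator, hence the
      inverse of (y,x) in place of (x,y).\<close>
    have "Ad G x y \<otimes> inv y = inv (commutator G y x)"
      using that x by (simp add: Ad_apply inv_commutator) (simp add: commutator_def)
    then show ?thesis
      using that x commutator_mem_lower_central_Suc lower_central_subgroup
      by (simp add: subgroup.m_inv_closed)
  qed
  then show ?thesis using x by (simp add: lower_central_shift_def Ad_auto)
qed

text \<open>\<open>Ad G x y \<otimes> inv y\<close> is literally the commutator of \<open>x\<close>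
  and \<open>y\<close>; this translates between the filtration on automorphisms and the series of
  \<open>G\<close>.\<close>

lemma Ad_shift_iff_commutator:
  assumes "x \<in> carrier G"
  shows "Ad G x \<in> lower_central_shift G s \<longleftrightarrow>
    (\<forall>u\<ge>1. \<forall>y\<in>lower_central G u. commutator G x y \<in> lower_central G (s + u))"
  using assms by (auto simp: lower_central_shift_def Ad_auto Ad_apply commutator_def)

text \<open>Takes the place of the three subgroups lemma: \<open>Ad\<close> sends \<Gamma>^s into
  shift s.\<close>

lemma commutator_lower_central:
  assumes "x \<in> lower_central G s" "y \<in> lower_central G u" "1 \<le> s" "1 \<le> u"
  shows "commutator G x y \<in> lower_central G (s + u)"
proof -
  have "Ad G x \<in> lower_central_shift G s"
    using assms hom_lower_central_shift[OF Ad_group_hom, of s] Ad_lower_central_shift by blast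
  then show ?thesis using assms Ad_shift_iff_commutator by auto
qed

lemma Inn_normal: "Inn G \<lhd> AutoGroup G"
proof -
  interpret A: group "AutoGroup G" by (rule AutoGroup)
  interpret Ad: group_hom G "AutoGroup G" "Ad G" by (rule Ad_group_hom)
  show ?thesis
  proof (rule A.normal_invI)
    show "subgroup (Inn G) (AutoGroup G)"
      unfolding Inn_def by (rule Ad.img_is_subgroup)
    fix \<alpha> \<iota> assume \<alpha>: "\<alpha> \<in> carrier (AutoGroup G)" and "\<iota> \<in> Inn G"
    then obtain x where x: "x \<in> carrier G" "\<iota> = Ad G x" by (auto simp: Inn_def)
    have auto: "\<alpha> \<in> auto G" "\<iota> \<in> auto G" "inv\<^bsub>AutoGroup G\<^esub> \<alpha> \<in> auto G"
      using \<alpha> x A.inv_closed by (auto simp: carrier_AutoGroup Ad_auto)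
    interpret \<alpha>: group_hom G G \<alpha> using auto_group_hom[OF auto(1)] .
    \<comment> \<open>This is \<alpha> Ad_x \<alpha>^-1 = Ad_(\<alpha> x) with the inverse moved to
      the other side, so that it can be checked pointwise.\<close>
    have "\<alpha> \<otimes>\<^bsub>AutoGroup G\<^esub> \<iota> = Ad G (\<alpha> x) \<otimes>\<^bsub>AutoGroup G\<^esub> \<alpha>"
      using auto x A.m_closed
      by (intro auto_eqI)
         (auto simp: carrier_AutoGroup mult_AutoGroup compose_def Ad_apply Ad_auto)
    then have "\<alpha> \<otimes>\<^bsub>AutoGroup G\<^esub> \<iota> \<otimes>\<^bsub>AutoGroup G\<^esub> inv\<^bsub>AutoGroup G\<^esub> \<alpha> = Ad G (\<alpha> x)"
      using auto x by (simp add: A.m_assoc carrier_AutoGroup Ad_auto)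
    then show "\<alpha> \<otimes>\<^bsub>AutoGroup G\<^esub> \<iota> \<otimes>\<^bsub>AutoGroup G\<^esub> inv\<^bsub>AutoGroup G\<^esub> \<alpha> \<in> Inn G"
      using auto x by (auto simp: Inn_def)
  qed
qed

end

section \<open>The Johnson filtration\<close>

context group
begin

text \<open>The set is the equalizer of two homomorphisms to G/N: the projection and its composite
  with \<alpha>. Its being a subgroup reduces a claim about \<Gamma>^(u+1) to commutators.\<close>

lemma subgroup_hom_congruent_id:
  assumes "\<alpha> \<in> hom G G" "N \<lhd> G"
  shows "subgroup {y \<in> carrier G. \<alpha> y \<otimes> inv y \<in> N} G"
proof -
  interpret \<alpha>: group_hom G G \<alpha> by unfold_locales fact
  interpret N: normal N G by fact
  show ?thesis
  proof (rule subgroupI)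
    fix y z assume "y \<in> {y \<in> carrier G. \<alpha> y \<otimes> inv y \<in> N}" "z \<in> {y \<in> carrier G. \<alpha> y \<otimes> inv y \<in> N}"
    then have c: "y \<in> carrier G" "z \<in> carrier G" "\<alpha> y \<otimes> inv y \<in> N" "\<alpha> z \<otimes> inv z \<in> N" by auto
    have "\<alpha> (y \<otimes> z) \<otimes> inv (y \<otimes> z) = (\<alpha> y \<otimes> inv y) \<otimes> (y \<otimes> (\<alpha> z \<otimes> inv z) \<otimes> inv y)"
      using c(1,2) by (simp add: inv_mult_group m_assoc)
    then show "y \<otimes> z \<in> {y \<in> carrier G. \<alpha> y \<otimes> inv y \<in> N}"
      using c N.inv_op_closed2[OF c(1,4)] by simp
  next
    fix y assume "y \<in> {y \<in> carrier G. \<alpha> y \<otimes> inv y \<in> N}"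
    then have c: "y \<in> carrier G" "\<alpha> y \<otimes> inv y \<in> N" by auto
    have "\<alpha> (inv y) \<otimes> inv (inv y) = inv y \<otimes> inv (\<alpha> y \<otimes> inv y) \<otimes> y"
      using c(1) by (simp add: inv_mult_group m_assoc)
    then show "inv y \<in> {y \<in> carrier G. \<alpha> y \<otimes> inv y \<in> N}"
      using c N.inv_op_closed1[OF c(1) N.m_inv_closed[OF c(2)]] by simp
  qed auto
qed

text \<open>An automorphism that acts trivially on \<open>G\<^sub>a\<^sub>b\<close> acts trivially on the graded Lie algebra, as
  \<open>gr\<^sub>\<Gamma>(G)\<close> is generated in degree \<open>1\<close>.\<close>

lemma johnson_filtration_1: "johnson_filtration G 1 = lower_central_shift G 1"
proof
  show "lower_central_shift G 1 \<subseteq> johnson_filtration G 1"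
    by (force simp: lower_central_shift_def johnson_filtration_def numeral_2_eq_2
        dest: spec[of _ "Suc 0"])
  show "johnson_filtration G 1 \<subseteq> lower_central_shift G 1"
  proof
    fix \<alpha> assume \<alpha>: "\<alpha> \<in> johnson_filtration G 1"
    then have auto: "\<alpha> \<in> auto G" by (simp add: johnson_filtration_def)
    interpret \<alpha>: group_hom G G \<alpha> using auto_group_hom[OF auto] .
    have "\<forall>y\<in>lower_central G u. \<alpha> y \<otimes> inv y \<in> lower_central G (Suc u)" if "1 \<le> u" for u
      using that
    proof (induction u rule: dec_induct)
      case base
      then show ?case using \<alpha> by (simp add: johnson_filtration_def)
    next
      case (step u)
      let ?N = "lower_central G (Suc (Suc u))"
      interpret N: normal ?N G by (rule lower_central_normal)
      obtain r where r: "u = Suc r" using step by (cases u) auto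
      have "\<alpha> (commutator G x z) \<otimes> inv (commutator G x z) \<in> ?N"
        if x: "x \<in> lower_central G u" and z: "z \<in> carrier G" for x z
      proof -
        \<comment> \<open>Here \<alpha> x = a x and \<alpha> z = w = c z; \<open>a\<close> is one
          step deeper than \<open>x\<close> by induction, and \<open>c\<close> lies in
          \<Gamma>^2.\<close>
        define a c w where "a = \<alpha> x \<otimes> inv x" and "c = \<alpha> z \<otimes> inv z" and "w = c \<otimes> z"
        have a: "a \<in> lower_central G (Suc u)" using x step.IH by (simp add: a_def)
        have c: "c \<in> lower_central G (Suc 1)"
          using z \<alpha> by (simp add: c_def johnson_filtration_def)
        have C: "a \<in> carrier G" "c \<in> carrier G" "x \<in> carrier G" "z \<in> carrier G" "w \<in> carrier G"
          using a c x z lower_central_carrier by (blast, blast, blast, blast, simp add: w_def c_def)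
        have \<alpha>x: "\<alpha> x = a \<otimes> x" "\<alpha> z = w"
          using C(3,4) by (simp_all add: a_def c_def w_def m_assoc)
        \<comment> \<open>The error made on replacing \<open>z\<close> by \<open>w\<close>:
          expanding (x, c z) gives (x,w) = n (x,z).\<close>
        define n where "n = commutator G x c \<otimes> inv (commutator G (commutator G x z) c)"
        have xz: "commutator G x z \<in> lower_central G (Suc u)"
          using x z step commutator_mem_lower_central_Suc by simp
        have n: "n \<in> ?N"
          unfolding n_def
          using commutator_lower_central[OF x c] commutator_mem_lower_central_Suc[OF _ xz C(2)] step
          by (intro N.m_closed N.m_inv_closed) auto
        have xw: "commutator G x w = n \<otimes> commutator G x z"
          using C(2,3,4) conj_eq_commutator_mult[of c "commutator G x z"]
          by (simp add: w_def n_def commutator_mult_right inv_commutator m_assoc)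
        have "\<alpha> (commutator G x z) = commutator G (a \<otimes> x) w"
          using C \<alpha>x by (simp add: \<alpha>.hom_commutator)
        \<comment> \<open>Expand (a x, w) and turn the conjugation by \<open>a\<close> into the
          factor (a,(x,w)). Every factor besides (x,z) lies in \<open>?N\<close>.\<close>
        also have "\<dots> = commutator G a (commutator G x w) \<otimes> (n \<otimes> commutator G x z) \<otimes> commutator G a w"
          using C by (simp add: commutator_mult_left conj_eq_commutator_mult flip: xw)
        finally have "\<alpha> (commutator G x z) \<otimes> inv (commutator G x z) =
            commutator G a (commutator G x w) \<otimes> n \<otimes>
            (commutator G x z \<otimes> commutator G a w \<otimes> inv (commutator G x z))"
          using C n by (simp add: m_assoc)
        moreover have "commutator G a (commutator G x w) \<in> ?N" "commutator G a w \<in> ?N"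
          using commutator_mem_lower_central_Suc[OF _ a] C by auto
        ultimately show ?thesis
          using n C N.inv_op_closed2[of "commutator G x z" "commutator G a w"] by simp
      qed
      then have "lower_central G (Suc u) \<subseteq> {y \<in> carrier G. \<alpha> y \<otimes> inv y \<in> ?N}"
        unfolding r lower_central.simps(3) commutator_subgroup_def
        by (intro generate_subgroup_incl subgroup_hom_congruent_id \<alpha>.homh N.normal_axioms
              [unfolded r lower_central.simps(3) commutator_subgroup_def]) auto
      then show ?case by auto
    qed
    then show "\<alpha> \<in> lower_central_shift G 1"
      using auto by (simp add: lower_central_shift_def)
  qed
qed


section \<open>The associated graded Lie algebra\<close>

lemma lower_central_normal_restrict:
  "lower_central G (Suc s) \<lhd> G\<lparr>carrier := lower_central G s\<rparr>"
  by (intro normal_restrict_supergroup lower_central_subgroup lower_central_normal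
      lower_central_Suc_subset)

lemma carrier_gr_piece:
  "carrier (gr_piece G (lower_central G) s) = (\<lambda>x. lower_central G (Suc s) #> x) ` lower_central G s"
  by (simp add: gr_piece_def carrier_FactGroup r_coset_def)

lemma one_gr_piece: "\<one>\<^bsub>gr_piece G (lower_central G) s\<^esub> = lower_central G (Suc s)"
  by (simp add: gr_piece_def)

lemma mem_gr_piece:
  assumes "A \<in> carrier (gr_piece G (lower_central G) s)"
  shows "A \<noteq> {}" "A \<subseteq> lower_central G s"
proof -
  obtain x where x: "x \<in> lower_central G s" "A = lower_central G (Suc s) #> x"
    using assms by (auto simp: carrier_gr_piece)
  show "A \<noteq> {}"
    using x rcos_self[OF _ lower_central_subgroup, of x "Suc s"] by auto
  show "A \<subseteq> lower_central G s"
    using x lower_central_Suc_subset[of s] subgroup.m_closed[OF lower_central_subgroup[of s]]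
    by (auto simp: r_coset_def)
qed

text \<open>Commutativity is what the finite product in the bracket of \<open>gr\<close> requires;
  it holds because (\<Gamma>^s, G) lies in \<Gamma>^(s+1).\<close>

lemma gr_piece_comm_group:
  assumes "1 \<le> s"
  shows "comm_group (gr_piece G (lower_central G) s)"
proof -
  let ?H = "G\<lparr>carrier := lower_central G s\<rparr>" and ?N = "lower_central G (Suc s)"
  interpret N: normal ?N ?H by (rule lower_central_normal_restrict)
  interpret Q: group "gr_piece G (lower_central G) s"
    unfolding gr_piece_def by (rule N.factorgroup_is_group)
  have "A \<otimes>\<^bsub>gr_piece G (lower_central G) s\<^esub> B = B \<otimes>\<^bsub>gr_piece G (lower_central G) s\<^esub> A"
    if AB: "A \<in> carrier (gr_piece G (lower_central G) s)" "B \<in> carrier (gr_piece G (lower_central G) s)"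
    for A B
  proof -
    obtain x y where xy: "x \<in> lower_central G s" "y \<in> lower_central G s"
      and A: "A = ?N #>\<^bsub>?H\<^esub> x" and B: "B = ?N #>\<^bsub>?H\<^esub> y"
      using AB by (auto simp: carrier_gr_piece r_coset_def)
    have c: "x \<in> carrier G" "y \<in> carrier G" using xy lower_central_carrier by blast+
    have "x \<otimes> y = commutator G x y \<otimes> (y \<otimes> x)"
      using c by (simp add: commutator_def m_assoc)
    moreover have "commutator G x y \<in> ?N"
      using commutator_mem_lower_central_Suc[OF assms xy(1) c(2)] .
    ultimately have "x \<otimes> y \<in> ?N #> (y \<otimes> x)"
      by (auto simp: r_coset_def)
    then have "?N #> (y \<otimes> x) = ?N #> (x \<otimes> y)"
      using c by (intro repr_independence lower_central_subgroup) auto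
    moreover have "A \<otimes>\<^bsub>gr_piece G (lower_central G) s\<^esub> B = ?N #> (x \<otimes> y)"
      using N.rcos_sum[of x y] xy by (simp add: gr_piece_def A B r_coset_def)
    moreover have "B \<otimes>\<^bsub>gr_piece G (lower_central G) s\<^esub> A = ?N #> (y \<otimes> x)"
      using N.rcos_sum[of y x] xy by (simp add: gr_piece_def A B r_coset_def)
    ultimately show ?thesis by simp
  qed
  then show ?thesis by (rule Q.group_comm_groupI)
qed

text \<open>The union under \<open>the_elem\<close> collapses to the singleton of the trivial coset;
  nonemptiness of \<open>A\<close> and \<open>B\<close> keeps it from being empty.\<close>

lemma gr_piece_bracket_eq_one:
  assumes "A \<noteq> {}" "B \<noteq> {}"
    and "\<And>x y. \<lbrakk>x \<in> A; y \<in> B\<rbrakk> \<Longrightarrow> commutator G x y \<in> lower_central G (Suc (s + t))"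
  shows "gr_piece_bracket G (lower_central G) s t A B = lower_central G (Suc (s + t))"
proof -
  have "lower_central G (Suc (s + t)) #> commutator G x y = lower_central G (Suc (s + t))"
    if "x \<in> A" "y \<in> B" for x y
    using assms(3)[OF that] lower_central_carrier by (intro coset_join2 lower_central_subgroup) auto
  then have "(\<Union>x\<in>A. \<Union>y\<in>B. {lower_central G (Suc (s + t)) #> commutator G x y})
      = {lower_central G (Suc (s + t))}"
    using assms(1,2) by auto
  then show ?thesis by (simp add: gr_piece_bracket_def)
qed

lemma carrier_gr_lcs:
  "carrier (gr_lcs G) = {u \<in> \<Pi>\<^sub>E n\<in>{1..}. carrier (gr_piece G (lower_central G) n).
      finite {n \<in> {1..}. u n \<noteq> \<one>\<^bsub>gr_piece G (lower_central G) n\<^esub>}}"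
proof -
  have "group (gr_piece G (lower_central G) n)" if "n \<in> {1..}" for n
    using gr_piece_comm_group that comm_group.axioms(2) by auto
  from carrier_sum_group[OF this, of "{1..}" "\<lambda>n. n"] show ?thesis by (simp add: gr_def)
qed

lemma gr_class_carrier:
  assumes "1 \<le> t" "x \<in> lower_central G t"
  shows "gr_class G (lower_central G) t x \<in> carrier (gr_lcs G)"
proof -
  have "\<one>\<^bsub>gr_piece G (lower_central G) n\<^esub> \<in> carrier (gr_piece G (lower_central G) n)"
    if "1 \<le> n" for n
    using gr_piece_comm_group[OF that] by (simp add: comm_group_def comm_monoid_def monoid.one_closed)
  moreover have "finite {n \<in> {1..}. gr_class G (lower_central G) t x n \<noteq>
      \<one>\<^bsub>gr_piece G (lower_central G) n\<^esub>}"
    by (rule finite_subset[of _ "{t}"]) (auto simp: gr_class_def)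
  ultimately show ?thesis
    using assms by (auto simp: carrier_gr_lcs gr_class_def carrier_gr_piece)
qed

text \<open>The condition concerns homogeneous elements, but each component of the bracket with any
  \<open>v\<close> is a finite product of brackets of homogeneous pieces, all trivial.\<close>

lemma gr_class_lie_center:
  assumes t: "1 \<le> t" and x: "x \<in> lower_central G t"
    and comm: "\<And>u y. \<lbrakk>1 \<le> u; y \<in> lower_central G u\<rbrakk> \<Longrightarrow> commutator G x y \<in> lower_central G (Suc (t + u))"
  shows "gr_class G (lower_central G) t x \<in> lie_center (gr_lcs G)"
proof -
  let ?z = "gr_class G (lower_central G) t x"
  have "bracket (gr_lcs G) ?z v = \<one>\<^bsub>gr_lcs G\<^esub>" if v: "v \<in> carrier (gr_lcs G)" for v
  proof -
    have v_mem: "v u \<in> carrier (gr_piece G (lower_central G) u)" if "1 \<le> u" for u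
      using v that by (auto simp: carrier_gr_lcs)
    have z_mem: "?z s \<in> carrier (gr_piece G (lower_central G) s)" if "1 \<le> s" for s
      using gr_class_carrier[OF t x] that by (auto simp: carrier_gr_lcs)
    have z_comm: "commutator G x' y \<in> lower_central G (Suc (s + u))"
      if "1 \<le> s" "1 \<le> u" and x': "x' \<in> ?z s" and y: "y \<in> lower_central G u" for s u x' y
    proof (cases "s = t")
      \<comment> \<open>Outside degree \<open>t\<close> the component of \<open>?z\<close> is the
        trivial coset \<Gamma>^(s+1), whose elements have commutators one degree deeper.\<close>
      case False
      then have "x' \<in> lower_central G (Suc s)"
        using that by (simp add: gr_class_def one_gr_piece)
      then show ?thesis using commutator_lower_central[of x' "Suc s" y u] that by simp
    next
      case True
      \<comment> \<open>In degree \<open>t\<close> the representatives are g x, and (g x, y) is a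
        conjugate of (x,y) times (g,y), both deep enough.\<close>
      then obtain g where g: "g \<in> lower_central G (Suc t)" "x' = g \<otimes> x"
        using x' t by (auto simp: gr_class_def r_coset_def)
      interpret N: normal "lower_central G (Suc (t + u))" G by (rule lower_central_normal)
      have "g \<in> carrier G" "x \<in> carrier G" "y \<in> carrier G" 
        using g x y lower_central_carrier by blast+
      then show ?thesis
        using True g that comm commutator_lower_central[OF g(1) y]
        by (simp add: commutator_mult_left N.inv_op_closed2)
    qed
    have "(\<Otimes>\<^bsub>gr_piece G (lower_central G) n\<^esub>s\<in>{1..<n}.
        gr_piece_bracket G (lower_central G) s (n - s) (?z s) (v (n - s))) =
      \<one>\<^bsub>gr_piece G (lower_central G) n\<^esub>" if n: "1 \<le> n" for n
    proof -
      interpret Q: comm_group "gr_piece G (lower_central G) n" by (rule gr_piece_comm_group[OF n])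
      show ?thesis
      proof (rule Q.finprod_one_eqI)
        fix s assume "s \<in> {1..<n}"
        then have s: "1 \<le> s" "1 \<le> n - s" "s + (n - s) = n" by auto
        have "gr_piece_bracket G (lower_central G) s (n - s) (?z s) (v (n - s)) =
            lower_central G (Suc (s + (n - s)))"
          using mem_gr_piece[OF z_mem[OF s(1)]] mem_gr_piece[OF v_mem[OF s(2)]] z_comm[OF s(1,2)]
          by (intro gr_piece_bracket_eq_one) auto
        then show "gr_piece_bracket G (lower_central G) s (n - s) (?z s) (v (n - s)) =
            \<one>\<^bsub>gr_piece G (lower_central G) n\<^esub>"
          using s by (simp add: one_gr_piece)
      qed
    qed
    then show ?thesis by (simp add: gr_def cong: restrict_cong)
  qed
  then show ?thesis using gr_class_carrier[OF t x] by (simp add: lie_center_def)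
qed

section \<open>Recovering the depth of x from that of Ad x\<close>

lemma Ad_shift_imp_lower_central:
  assumes center: "lie_center (gr_lcs G) = {\<one>\<^bsub>gr_lcs G\<^esub>}"
    and x: "x \<in> carrier G" and "1 \<le> s" "Ad G x \<in> lower_central_shift G s"
  shows "x \<in> lower_central G s"
  using \<open>1 \<le> s\<close> \<open>Ad G x \<in> lower_central_shift G s\<close>
proof (induction s rule: dec_induct)
  case base
  then show ?case using x by simp
next
  case (step s)
  \<comment> \<open>Shift s+1 puts (x,y) one step beyond degree s+u, where the bracket of the
    classes of \<open>x\<close> and \<open>y\<close> lives; this makes the class of \<open>x\<close>
    central.\<close>
  have comm: "commutator G x y \<in> lower_central G (Suc (s + u))"
    if "1 \<le> u" "y \<in> lower_central G u" for u y
    using that step.prems x by (simp add: Ad_shift_iff_commutator)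
  then have "Ad G x \<in> lower_central_shift G s"
    using x lower_central_Suc_subset by (auto simp: Ad_shift_iff_commutator)
  then have xs: "x \<in> lower_central G s" by (rule step.IH)
  have "gr_class G (lower_central G) s x = \<one>\<^bsub>gr_lcs G\<^esub>"
    using gr_class_lie_center[OF step.hyps(1) xs comm] center by auto
  then have "gr_class G (lower_central G) s x s = \<one>\<^bsub>gr_lcs G\<^esub> s" by simp
  then have "lower_central G (Suc s) #> x = lower_central G (Suc s)"
    using step.hyps by (simp add: gr_class_def gr_def one_gr_piece)
  then show ?case using coset_join1 x lower_central_subgroup by blast
qed

text \<open>The identity has every shift, so an element of the kernel lies in every \<Gamma>^s, and
  residual nilpotence applies.\<close>

lemma Ad_inj:
  assumes "residually_nilpotent G" "lie_center (gr_lcs G) = {\<one>\<^bsub>gr_lcs G\<^esub>}"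
  shows "inj_on (Ad G) (carrier G)"
proof -
  interpret Ad: group_hom G "AutoGroup G" "Ad G" by (rule Ad_group_hom)
  have "x = \<one>" if x: "x \<in> carrier G" "Ad G x = \<one>\<^bsub>AutoGroup G\<^esub>" for x
  proof -
    have "x \<in> lower_central G s" if "1 \<le> s" for s
      using Ad_shift_imp_lower_central[OF assms(2) x(1) that] x(2)
        subgroup.one_closed[OF lower_central_shift_subgroup[of s]] by simp
    then show ?thesis using assms(1) by (auto simp: residually_nilpotent_def)
  qed
  then show ?thesis by (auto simp: Ad.inj_on_one_iff)
qed


section \<open>Torelli groups\<close>

lemma torelli_subgroup: "subgroup (johnson_filtration G 1) (AutoGroup G)"
  unfolding johnson_filtration_1 by (rule lower_central_shift_subgroup)

lemma carrier_torelli: "carrier (torelli G) = johnson_filtration G 1"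
  by (simp add: torelli_def)

lemma one_torelli: "\<one>\<^bsub>torelli G\<^esub> = \<one>\<^bsub>AutoGroup G\<^esub>"
  by (simp add: torelli_def)

lemma torelli_group: "group (torelli G)"
  unfolding torelli_def using AutoGroup subgroup.subgroup_is_group torelli_subgroup by blast

lemma lower_central_torelli_shift:
  assumes "1 \<le> s"
  shows "lower_central (torelli G) s \<subseteq> lower_central_shift G s"
proof -
  interpret T: group "torelli G" by (rule torelli_group)
  interpret A: group "AutoGroup G" by (rule AutoGroup)
  \<comment> \<open>\<open>id\<close> is the inclusion into the automorphism group; it carries the
    series formed inside the Torelli group into the shift filtration.\<close>
  have "id \<in> hom (torelli G) (AutoGroup G)"
    using subgroup.subset[OF torelli_subgroup] by (auto simp: hom_def torelli_def)
  then have "group_hom (torelli G) (AutoGroup G) id"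
    by unfold_locales
  from hom_lower_central_shift[OF this _ assms] show ?thesis
    by (simp add: carrier_torelli johnson_filtration_1 del: One_nat_def)
qed

lemma Ad_torelli_hom: "group_hom G (torelli G) (Ad G)"
proof -
  interpret T: group "torelli G" by (rule torelli_group)
  interpret Ad: group_hom G "AutoGroup G" "Ad G" by (rule Ad_group_hom)
  have "Ad G \<in> hom G (torelli G)"
    using Ad.homh Ad_lower_central_shift
    by (auto simp: hom_def torelli_def johnson_filtration_1 simp del: One_nat_def)
  then show ?thesis by unfold_locales
qed

lemma out_proj_hom: "group_hom (AutoGroup G) (Out G) (out_proj G)"
proof -
  interpret Inn: normal "Inn G" "AutoGroup G" by (rule Inn_normal)
  have "out_proj G \<in> hom (AutoGroup G) (Out G)"
    using Inn.r_coset_hom_Mod unfolding out_proj_def Out_def by simp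
  then show ?thesis
    using Inn.factorgroup_is_group AutoGroup by (simp add: group_hom_def group_hom_axioms_def Out_def)
qed

lemma out_proj_torelli_hom: "group_hom (torelli G) (outer_torelli G) (out_proj G)"
  unfolding torelli_def outer_torelli_def carrier_torelli
  using group_hom.induced_group_hom[OF out_proj_hom torelli_subgroup] by simp

text \<open>The identity of \<open>outer_torelli G\<close> is inherited from \<open>Out G\<close>:
  it is the coset \<open>Inn G\<close> itself.\<close>

lemma out_proj_eq_one_iff:
  assumes "\<alpha> \<in> auto G"
  shows "out_proj G \<alpha> = \<one>\<^bsub>outer_torelli G\<^esub> \<longleftrightarrow> \<alpha> \<in> Inn G"
proof -
  interpret A: group "AutoGroup G" by (rule AutoGroup)
  have "subgroup (Inn G) (AutoGroup G)" using Inn_normal normal_imp_subgroup by blast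
  then show ?thesis
    using assms A.coset_join1 A.coset_join2
    by (auto simp: out_proj_def outer_torelli_def Out_def carrier_AutoGroup)
qed

end

section \<open>Exactness of the restricted sequence\<close>

lemma (in group_hom) group_hom_restrict:
  assumes "subgroup A G" "subgroup B H" "h ` A \<subseteq> B"
  shows "group_hom (G\<lparr>carrier := A\<rparr>) (H\<lparr>carrier := B\<rparr>) h"
proof -
  have "h \<in> hom (G\<lparr>carrier := A\<rparr>) (H\<lparr>carrier := B\<rparr>)"
    using assms subgroup.subset[OF assms(1)] by (auto simp: hom_def subset_iff image_subset_iff)
  then show ?thesis
    using assms subgroup.subgroup_is_group[OF _ G.group_axioms]
      subgroup.subgroup_is_group[OF _ H.group_axioms]
    by (simp add: group_hom_def group_hom_axioms_def)
qed

theorem proposition1p3: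
  fixes G :: "('a, 'b) monoid_scheme" and q :: nat
  assumes "group G"
    and "residually_nilpotent G"
    and "q \<ge> 1"
    and "lie_center (gr_lcs G) = {\<one>\<^bsub>gr_lcs G\<^esub>}"
    and "\<And>s. 1 \<le> s \<Longrightarrow> s \<le> q \<Longrightarrow>
           inj_on (johnson_hom G s \<circ> iota_F G s)
             (carrier (gr_piece (torelli G) (lower_central (torelli G)) s))"
  shows "\<forall>s. 1 \<le> s \<and> s \<le> q + 1 \<longrightarrow>
    short_exact
      (G\<lparr>carrier := lower_central G s\<rparr>)
      ((torelli G)\<lparr>carrier := lower_central (torelli G) s\<rparr>)
      ((outer_torelli G)\<lparr>carrier := lower_central (outer_torelli G) s\<rparr>)
      (Ad G) (out_proj G)"
proof (intro allI impI)
  fix s :: nat assume "1 \<le> s \<and> s \<le> q + 1"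
  then have s: "1 \<le> s" by simp
  interpret group G by fact
  interpret Ad: group_hom G "torelli G" "Ad G" by (rule Ad_torelli_hom)
  interpret P: group_hom "torelli G" "outer_torelli G" "out_proj G" by (rule out_proj_torelli_hom)
  let ?\<Gamma> = "lower_central G s" and ?T = "lower_central (torelli G) s"
    and ?O = "lower_central (outer_torelli G) s"
  have Ad_img: "Ad G ` ?\<Gamma> \<subseteq> ?T" by (rule Ad.img_lower_central_subset)
  \<comment> \<open>The carrier of \<open>outer_torelli G\<close> is by definition the image of
    \<open>out_proj G\<close>, so each term of the series is hit as well.\<close>
  have P_img: "out_proj G ` ?T = ?O"
    by (rule P.img_lower_central) (simp add: outer_torelli_def)
  have T_shift: "?T \<subseteq> lower_central_shift G s" by (rule lower_central_torelli_shift[OF s])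
  have "Ad G ` ?\<Gamma> = ?T \<inter> Inn G"
  proof
    show "Ad G ` ?\<Gamma> \<subseteq> ?T \<inter> Inn G" using Ad_img by (auto simp: Inn_def)
    \<comment> \<open>Such an element is \<open>Ad G x\<close> of shift s, and the trivial center
      forces \<open>x\<close> into \<Gamma>^s.\<close>
    show "?T \<inter> Inn G \<subseteq> Ad G ` ?\<Gamma>"
      using Ad_shift_imp_lower_central[OF assms(4) _ s] T_shift by (auto simp: Inn_def)
  qed
  also have "\<dots> = {\<alpha> \<in> ?T. out_proj G \<alpha> = \<one>\<^bsub>outer_torelli G\<^esub>}"
    using out_proj_eq_one_iff T_shift lower_central_shift_subset by blast
  finally have "Ad G ` ?\<Gamma> = {\<alpha> \<in> ?T. out_proj G \<alpha> = \<one>\<^bsub>outer_torelli G\<^esub>}" .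
  moreover have "inj_on (Ad G) ?\<Gamma>"
    using Ad_inj[OF assms(2,4)] lower_central_subset by (rule inj_on_subset)
  moreover have "group_hom (G\<lparr>carrier := ?\<Gamma>\<rparr>) ((torelli G)\<lparr>carrier := ?T\<rparr>) (Ad G)"
    by (intro Ad.group_hom_restrict lower_central_subgroup Ad.H.lower_central_subgroup Ad_img)
  moreover have "group_hom ((torelli G)\<lparr>carrier := ?T\<rparr>) ((outer_torelli G)\<lparr>carrier := ?O\<rparr>) (out_proj G)"
    using P_img
    by (intro P.group_hom_restrict Ad.H.lower_central_subgroup P.H.lower_central_subgroup) simp
  ultimately show "short_exact (G\<lparr>carrier := ?\<Gamma>\<rparr>) ((torelli G)\<lparr>carrier := ?T\<rparr>)
      ((outer_torelli G)\<lparr>carrier := ?O\<rparr>) (Ad G) (out_proj G)"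
    using P_img by (simp add: short_exact_def kernel_def)
qed

end
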